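(* Let $a$ be an individual parameter and $f$ a unary function symbol. The sequent $a=f(a)\Rightarrow a=f(f(a))$ is derivable in $EQ_M$ but is not derivable in $EQ_M^-$ (that is, it has no derivation in $EQ_M$ that does not use the contraction rule). Hence the contraction rule is not eliminable from derivations of $EQ_M$.
   Context: Fix a first-order language with equality $=$ that contains the individual parameter $a$ (an atomic term) and the unary function symbol $f$. Terms are denoted $r,s,t,p,q$. Arbitrary formulae are denoted $F,G,H$; $A$ and $D$ always denote atomic formulae (equalities between terms are atomic formulae). $D\{v/r\}$ is the result of substituting the term $r$ for every occurrence of the variable $v$ in $D$. A sequent is $\Gamma\Rightarrow H$, where $\Gamma$ is a finite (possibly empty) sequence of formulae and exactly one formula $H$ is in the succedent. The calculus $EQ_M$ has: - logical axioms $A\Rightarrow A$ ($A$ atomic); - reflexivity axioms $\Rightarrow t=t$; - weakening: from $\Gamma\Rightarrow H$ infer $\Gamma,F\Rightarrow H$; - exchange: from $\Gamma_1,F,G,\Gamma_2\Rightarrow H$ infer $\Gamma_1,G,F,\Gamma_2\Rightarrow H$; - contraction: from $\Gamma,F,F\Rightarrow H$ infer $\Gamma,F\Rightarrow H$; - atomic cut: from $\Gamma\Rightarrow A$ and $\Lambda,A\Rightarrow H$ infer $\Gamma,\Lambda\Rightarrow H$ ($A$ atomic); - rule $=_1\Rightarrow$: from $\Gamma\Rightarrow D\{v/r\}$ infer $\Gamma,r=s\Rightarrow D\{v/s\}$ ($D$ atomic); - rule $=_2\Rightarrow$: from $\Gamma\Rightarrow D\{v/r\}$ infer $\Gamma,s=r\Rightarrow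 D\{v/s\}$ ($D$ atomic). $EQ_M^-$ is $EQ_M$ without the contraction rule. A rule is eliminable from derivations of a calculus if every sequent derivable in the calculus has a derivation in it that does not use the rule. *)

theory Defs
  imports Main
begin

text \<open>
  A first-order language with equality. Function and predicate symbols come with an arity;
  a symbol mapped to \<^term>\<open>None\<close> does not belong to the language. There is a countably infinite
  supply of variables, disjoint from the individual parameters. Equality is a logical symbol,
  so it is not among the predicate symbols.
\<close>

record ('c, 'f, 'p) language =
  params :: "'c set"
  fun_arity :: "'f \<Rightarrow> nat option"
  pred_arity :: "'p \<Rightarrow> nat option"

datatype ('c, 'f) trm = Var nat | Par 'c | Fun 'f "('c, 'f) trm list"

datatype ('c, 'f, 'p) fm =
    Eq "('c, 'f) trm" "('c, 'f) trm"
  | Pred 'p "('c, 'f) trm list"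
  | Neg "('c, 'f, 'p) fm"
  | Conj "('c, 'f, 'p) fm" "('c, 'f, 'p) fm"
  | Disj "('c, 'f, 'p) fm" "('c, 'f, 'p) fm"
  | Imp "('c, 'f, 'p) fm" "('c, 'f, 'p) fm"
  | All nat "('c, 'f, 'p) fm"
  | Exi nat "('c, 'f, 'p) fm"

fun is_term :: "('c, 'f, 'p) language \<Rightarrow> ('c, 'f) trm \<Rightarrow> bool" where
  "is_term L (Var x) \<longleftrightarrow> True"
| "is_term L (Par c) \<longleftrightarrow> c \<in> params L"
| "is_term L (Fun g ts) \<longleftrightarrow> fun_arity L g = Some (length ts) \<and> (\<forall>t \<in> set ts. is_term L t)"

fun is_formula :: "('c, 'f, 'p) language \<Rightarrow> ('c, 'f, 'p) fm \<Rightarrow> bool" where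
  "is_formula L (Eq s t) \<longleftrightarrow> is_term L s \<and> is_term L t"
| "is_formula L (Pred P ts) \<longleftrightarrow> pred_arity L P = Some (length ts) \<and> (\<forall>t \<in> set ts. is_term L t)"
| "is_formula L (Neg F) \<longleftrightarrow> is_formula L F"
| "is_formula L (Conj F G) \<longleftrightarrow> is_formula L F \<and> is_formula L G"
| "is_formula L (Disj F G) \<longleftrightarrow> is_formula L F \<and> is_formula L G"
| "is_formula L (Imp F G) \<longleftrightarrow> is_formula L F \<and> is_formula L G"
| "is_formula L (All x F) \<longleftrightarrow> is_formula L F"
| "is_formula L (Exi x F) \<longleftrightarrow> is_formula L F"

definition is_atomic :: "('c, 'f, 'p) language \<Rightarrow> ('c, 'f, 'p) fm \<Rightarrow> bool" where
  "is_atomic L A \<longleftrightarrow> is_formula L A \<and> ((\<exists>s t. A = Eq s t) \<or> (\<exists>P ts. A = Pred P ts))"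

primrec subst_trm :: "('c, 'f) trm \<Rightarrow> nat \<Rightarrow> ('c, 'f) trm \<Rightarrow> ('c, 'f) trm" where
  "subst_trm (Var x) v r = (if x = v then r else Var x)"
| "subst_trm (Par c) v r = Par c"
| "subst_trm (Fun g ts) v r = Fun g (map (\<lambda>t. subst_trm t v r) ts)"

text \<open>
  \<open>D{v/r}\<close> is only ever used for atomic \<open>D\<close>; on compound formulae the function below is a dummy
  (the identity), so that bound variables need not be considered.
\<close>

fun subst_atom :: "('c, 'f, 'p) fm \<Rightarrow> nat \<Rightarrow> ('c, 'f) trm \<Rightarrow> ('c, 'f, 'p) fm" where
  "subst_atom (Eq s t) v r = Eq (subst_trm s v r) (subst_trm t v r)"
| "subst_atom (Pred P ts) v r = Pred P (map (\<lambda>t. subst_trm t v r) ts)"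
| "subst_atom F v r = F"

datatype ('c, 'f, 'p) sequent =
  Sequent "('c, 'f, 'p) fm list" "('c, 'f, 'p) fm"  (infix "\<rightarrowtail>" 50)

datatype rule =
    Logical_Axiom | Reflexivity_Axiom
  | Weakening | Exchange | Contraction | Atomic_Cut
  | Eq1_Left | Eq2_Left

text \<open>
  \<open>inference L \<rho> Ps S\<close>: the sequent \<open>S\<close> is obtained from the list of premises \<open>Ps\<close> by one
  application of \<open>\<rho>\<close>; axioms are rules without premises. Membership in the language is required
  of whatever an inference introduces, so that every derivable sequent consists of formulae of
  \<open>L\<close>.
\<close>

inductive inference ::
  "('c, 'f, 'p) language \<Rightarrow> rule \<Rightarrow> ('c, 'f, 'p) sequent list \<Rightarrow> ('c, 'f, 'p) sequent \<Rightarrow> bool"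
  for L where
  logical_axiom:
    "is_atomic L A \<Longrightarrow> inference L Logical_Axiom [] ([A] \<rightarrowtail> A)"
| reflexivity_axiom:
    "is_term L t \<Longrightarrow> inference L Reflexivity_Axiom [] ([] \<rightarrowtail> Eq t t)"
| weakening:
    "is_formula L F \<Longrightarrow> inference L Weakening [\<Gamma> \<rightarrowtail> H] (\<Gamma> @ [F] \<rightarrowtail> H)"
| exchange:
    "inference L Exchange [\<Gamma>1 @ [F, G] @ \<Gamma>2 \<rightarrowtail> H] (\<Gamma>1 @ [G, F] @ \<Gamma>2 \<rightarrowtail> H)"
| contraction:
    "inference L Contraction [\<Gamma> @ [F, F] \<rightarrowtail> H] (\<Gamma> @ [F] \<rightarrowtail> H)"
| atomic_cut:
    "is_atomic L A \<Longrightarrow>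
     inference L Atomic_Cut [\<Gamma> \<rightarrowtail> A, \<Lambda> @ [A] \<rightarrowtail> H] (\<Gamma> @ \<Lambda> \<rightarrowtail> H)"
| eq1_left:
    "is_atomic L D \<Longrightarrow> is_term L r \<Longrightarrow> is_term L s \<Longrightarrow>
     inference L Eq1_Left [\<Gamma> \<rightarrowtail> subst_atom D v r] (\<Gamma> @ [Eq r s] \<rightarrowtail> subst_atom D v s)"
| eq2_left:
    "is_atomic L D \<Longrightarrow> is_term L r \<Longrightarrow> is_term L s \<Longrightarrow>
     inference L Eq2_Left [\<Gamma> \<rightarrowtail> subst_atom D v r] (\<Gamma> @ [Eq s r] \<rightarrowtail> subst_atom D v s)"

text \<open>A calculus over a language is given by its set of rules.\<close>

inductive derivable ::
  "('c, 'f, 'p) language \<Rightarrow> rule set \<Rightarrow> ('c, 'f, 'p) sequent \<Rightarrow> bool"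
  for L and R where
  step:
    "\<rho> \<in> R \<Longrightarrow> inference L \<rho> Ps S \<Longrightarrow> (\<forall>P \<in> set Ps. derivable L R P) \<Longrightarrow> derivable L R S"

definition EQ_M :: "rule set" where
  "EQ_M = {Logical_Axiom, Reflexivity_Axiom, Weakening, Exchange, Contraction, Atomic_Cut,
           Eq1_Left, Eq2_Left}"

definition EQ_M_minus :: "rule set" where
  "EQ_M_minus = EQ_M - {Contraction}"

definition eliminable :: "('c, 'f, 'p) language \<Rightarrow> rule \<Rightarrow> rule set \<Rightarrow> bool" where
  "eliminable L \<rho> R \<longleftrightarrow> (\<forall>S. derivable L R S \<longrightarrow> derivable L (R - {\<rho>}) S)"

end

theory Submission
  imports Defs
begin

text \<open>
  Interpret every term as a natural number, \<open>f\<close> as the successor and everything else as \<open>0\<close>, and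
  let an equation weigh the distance between its two sides. As a function of a variable, a term is
  either constant or a translation, so replacing \<open>r\<close> by \<open>s\<close> in an atom, at any number of places
  simultaneously, increases its weight by at most the weight of \<open>r = s\<close>. Hence without contraction
  the succedent weighs at most as much as the antecedents together, whereas \<open>a = f(a)\<close> has weight
  \<open>1\<close> and \<open>a = f(f(a))\<close> has weight \<open>2\<close>. Contraction loses the multiplicity of the antecedents.
\<close>

text \<open>Integer values keep the subtraction in \<open>weight\<close> from truncating at
  \<open>0\<close>.\<close>

fun height :: "'f \<Rightarrow> ('c, 'f) trm \<Rightarrow> int" where
  "height f (Fun g [t]) = (if g = f then height f t + 1 else 0)"
| "height f t = 0"

fun weight :: "'f \<Rightarrow> ('c, 'f, 'p) fm \<Rightarrow> int" where
  "weight f (Eq s t) = \<bar>height f s - height f t\<bar>"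
| "weight f F = 0"

lemma weight_nonneg: "weight f F \<ge> 0"
  by (cases F) auto

text \<open>Strip the leading \<open>f\<close>s of \<open>t\<close>: if \<open>v\<close> remains,
  their number is the shift; otherwise the substitution cannot affect the height.\<close>

lemma height_subst_trm:
  obtains n where "\<And>r. height f (subst_trm t v r) = n"
  | n where "\<And>r. height f (subst_trm t v r) = height f r + n"
proof -
  have "(\<exists>n. \<forall>r. height f (subst_trm t v r) = n) \<or>
        (\<exists>n. \<forall>r. height f (subst_trm t v r) = height f r + n)"
  proof (induction f t rule: height.induct)
    case (1 f g t)
    then show ?case
      by (cases "g = f") (auto simp: algebra_simps intro: exI[of _ "_ + 1"])
  qed auto
  then show thesis
    using that by blast
qed

text \<open>If both sides are constant or both are shifted, the weight does not change; otherwise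
  the triangle inequality applies.\<close>

lemma weight_subst_atom_le:
  "weight f (subst_atom D v s) \<le> weight f (subst_atom D v r) + weight f (Eq r s)"
proof (cases D)
  case (Eq p q)
  show ?thesis
    by (cases rule: height_subst_trm[of f p v]; cases rule: height_subst_trm[of f q v])
       (auto simp: Eq)
qed auto

fun weight_bounded :: "'f \<Rightarrow> ('c, 'f, 'p) sequent \<Rightarrow> bool" where
  "weight_bounded f (\<Gamma> \<rightarrowtail> H) \<longleftrightarrow> weight f H \<le> (\<Sum>F\<leftarrow>\<Gamma>. weight f F)"

lemma inference_weight_bounded:
  assumes "inference L \<rho> Ps S" and "\<rho> \<noteq> Contraction" and "\<forall>P \<in> set Ps. weight_bounded f P"
  shows "weight_bounded f S"
  using assms
proof cases
  case (weakening F \<Gamma> H)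
  then show ?thesis
    using assms(3) weight_nonneg[of f F] by simp
next
  case (eq1_left D r s \<Gamma> v)
  then show ?thesis
    using assms(3) weight_subst_atom_le[of f D v s r] by simp
next
  case (eq2_left D r s \<Gamma> v)
  then show ?thesis
    using assms(3) weight_subst_atom_le[of f D v s r] by (simp add: abs_minus_commute)
qed auto

lemma derivable_weight_bounded:
  assumes "derivable L R S" and "Contraction \<notin> R"
  shows "weight_bounded f S"
  using assms(1)
proof induction
  case (step \<rho> Ps S)
  then show ?case
    using assms(2) inference_weight_bounded[of L \<rho> Ps S f] by blast
qed

theorem mainTheorem1:
  fixes L :: "('c, 'f, 'p) language" and a :: 'c and f :: 'f
  assumes "a \<in> params L" and "fun_arity L f = Some 1"
  shows "derivable L EQ_M
           ([Eq (Par a) (Fun f [Par a])] \<rightarrowtail> Eq (Par a) (Fun f [Fun f [Par a]]))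
       \<and> \<not> derivable L EQ_M_minus
           ([Eq (Par a) (Fun f [Par a])] \<rightarrowtail> Eq (Par a) (Fun f [Fun f [Par a]]))
       \<and> \<not> eliminable L Contraction EQ_M"
proof -
  let ?E = "Eq (Par a) (Fun f [Par a]) :: ('c, 'f, 'p) fm"
  let ?H = "Eq (Par a) (Fun f [Fun f [Par a]]) :: ('c, 'f, 'p) fm"
  \<comment> \<open>Only the inner \<open>a\<close> of \<open>a = f(a)\<close> is made replaceable,
    so putting \<open>f(a)\<close> there leaves the left side alone.\<close>
  let ?D = "Eq (Par a) (Fun f [Var 0]) :: ('c, 'f, 'p) fm"
  have "inference L Logical_Axiom [] ([?E] \<rightarrowtail> ?E)"
    using assms by (intro logical_axiom) (simp add: is_atomic_def)
  then have 1: "derivable L EQ_M ([?E] \<rightarrowtail> ?E)"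
    by (rule derivable.step[rotated]) (simp_all add: EQ_M_def)
  have "inference L Eq1_Left [[?E] \<rightarrowtail> subst_atom ?D 0 (Par a)]
          ([?E] @ [?E] \<rightarrowtail> subst_atom ?D 0 (Fun f [Par a]))"
    using assms by (intro eq1_left) (simp_all add: is_atomic_def)
  then have 2: "derivable L EQ_M ([?E, ?E] \<rightarrowtail> ?H)"
    using 1 by (intro derivable.step[of Eq1_Left _ _ "[[?E] \<rightarrowtail> ?E]"]) (simp_all add: EQ_M_def)
  have "inference L Contraction [[?E, ?E] \<rightarrowtail> ?H] ([?E] \<rightarrowtail> ?H)"
    using contraction[of L "[]" ?E ?H] by simp
  then have pos: "derivable L EQ_M ([?E] \<rightarrowtail> ?H)"
    by (rule derivable.step[rotated]) (simp_all add: EQ_M_def 2[unfolded EQ_M_def])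
  have "\<not> weight_bounded f ([?E] \<rightarrowtail> ?H)"
    by simp
  then have neg: "\<not> derivable L EQ_M_minus ([?E] \<rightarrowtail> ?H)"
    using derivable_weight_bounded[of L EQ_M_minus "[?E] \<rightarrowtail> ?H" f]
    by (auto simp: EQ_M_minus_def)
  show ?thesis
    using pos neg unfolding eliminable_def EQ_M_minus_def by blast
qed

end
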